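(* Let $\mathbf M = \langle Q \cup \Sigma \cup \{0\}; \cdot\rangle$ be a finite automatic algebra. Then $\mathbf M$ is inherently non-dualizable if there exists $a \in \Sigma$ such that one of the following conditions holds: \begin{enumerate} \item there are $q \in \operatorname{kill}(a)$ and $w \in \Sigma^*$ such that $qw \in \operatorname{dom}(a)$; \item there are $q \in \operatorname{ran}(a)$ and $w \in \Sigma^*$ such that $qw \in \operatorname{kill}(a)$. \end{enumerate}
   Context: **Automatic algebras.** An automatic algebra is an algebra with a single binary operation $\mathbf M = \langle Q \cup \Sigma \cup \{0\}; \cdot\rangle$, where $Q$ (states) and $\Sigma$ (letters) are disjoint sets and $0 \notin Q\cup\Sigma$, that encodes a partial (deterministic) automaton: each letter $a \in \Sigma$ acts as a partial map $Q \to Q$; for $q,r\in Q$ and $a \in \Sigma$ we have $q\cdot a = r$ iff $a$ sends $q$ to $r$; all other products are $0$. Products are bracketed from the left: $uv_1v_2\cdots v_n := (\cdots((u\cdot v_1)\cdot v_2)\cdots)\cdot v_n$. For $a\in\Sigma$: $\operatorname{dom}(a) := \{q\in Q \mid qa\neq 0\}$, $\operatorname{ran}(a) := \{qa \mid q\in\operatorname{dom}(a)\}$, $\operatorname{kill}(a) := Q\setminus\operatorname{dom}(a)$. $\Sigma^*$ is the set of all words $a_1a_2\dots a_n$ with $n\ge 0$ and $a_i\in\Sigma$; for such a word $w$, $qw := qa_1a_2\cdots a_n$ (which is $q$ if $w$ is empty). **Dualizability.** Let $\mathbf M$ be a finite algebra with universe $M$. A $k$-ary relation on $M$ ($k\ge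 1$) is compatible with $\mathbf M$ if it is a subuniverse of $\mathbf M^k$. For $\mathbf A \in \mathbb{ISP}(\mathbf M)$ (isomorphic copies of subalgebras of powers of $\mathbf M$), view $\hom(\mathbf A,\mathbf M)\subseteq M^A$ with the subspace topology of the product topology ($M$ discrete), and with relations on $M$ interpreted pointwise. A map $f\colon \hom(\mathbf A,\mathbf M)\to M$ is an evaluation if there is $a\in A$ with $f(x)=x(a)$ for all $x$. The algebra $\mathbf M$ is dualizable if, for every $\mathbf A\in\mathbb{ISP}(\mathbf M)$, every continuous map $f\colon\hom(\mathbf A,\mathbf M)\to M$ that preserves all finitary compatible relations on $\mathbf M$ is an evaluation. A finite algebra $\mathbf M$ is inherently non-dualizable if every finite algebra (of the same type) that has $\mathbf M$ as a subalgebra is non-dualizable. *)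

theory Defs
  imports "HOL-Analysis.Function_Topology" "HOL-Algebra.Congruence"
    "HOL-Library.Infinite_Typeclass"
begin

section \<open>Algebras with one binary operation\<close>

record 'a groupoid = "'a partial_object" +
  app :: "'a \<Rightarrow> 'a \<Rightarrow> 'a" (infixl "\<cdot>\<index>" 70)

definition algebra :: "('a, 'm) groupoid_scheme \<Rightarrow> bool" where
  "algebra M \<longleftrightarrow> carrier M \<noteq> {} \<and> (\<forall>x\<in>carrier M. \<forall>y\<in>carrier M. x \<cdot>\<^bsub>M\<^esub> y \<in> carrier M)"

definition subuniverse :: "'a set \<Rightarrow> ('a, 'm) groupoid_scheme \<Rightarrow> bool" where
  "subuniverse S M \<longleftrightarrow> S \<subseteq> carrier M \<and> (\<forall>x\<in>S. \<forall>y\<in>S. x \<cdot>\<^bsub>M\<^esub> y \<in> S)"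

definition subalgebra :: "('a, 'm) groupoid_scheme \<Rightarrow> ('a, 'n) groupoid_scheme \<Rightarrow> bool" where
  "subalgebra A M \<longleftrightarrow> algebra A \<and> carrier A \<subseteq> carrier M \<and>
     (\<forall>x\<in>carrier A. \<forall>y\<in>carrier A. x \<cdot>\<^bsub>A\<^esub> y = x \<cdot>\<^bsub>M\<^esub> y)"

definition power_algebra :: "('a, 'm) groupoid_scheme \<Rightarrow> 'i set \<Rightarrow> ('i \<Rightarrow> 'a) groupoid" where
  "power_algebra M I =
     \<lparr>carrier = (\<Pi>\<^sub>E i\<in>I. carrier M), app = (\<lambda>x y. \<lambda>i\<in>I. x i \<cdot>\<^bsub>M\<^esub> y i)\<rparr>"

text \<open>Homomorphisms are extensional, so that they are points of the product
  \<^term>\<open>\<Pi>\<^sub>E a\<in>carrier A. carrier M\<close>.\<close>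

definition homs :: "('a, 'm) groupoid_scheme \<Rightarrow> ('b, 'n) groupoid_scheme \<Rightarrow> ('a \<Rightarrow> 'b) set" where
  "homs A M = {x \<in> carrier A \<rightarrow>\<^sub>E carrier M.
     \<forall>a\<in>carrier A. \<forall>b\<in>carrier A. x (a \<cdot>\<^bsub>A\<^esub> b) = x a \<cdot>\<^bsub>M\<^esub> x b}"

definition isomorphic :: "('a, 'm) groupoid_scheme \<Rightarrow> ('b, 'n) groupoid_scheme \<Rightarrow> bool" where
  "isomorphic A B \<longleftrightarrow> (\<exists>h\<in>homs A B. bij_betw h (carrier A) (carrier B))"

text \<open>The exponents of the powers have to be sets over a fixed type. Sets of functions from
  \<open>A\<close> to \<open>M\<close> suffice: see \<open>in_ISP_I\<close> below, where the exponent is arbitrary.\<close>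

definition in_ISP :: "('a, 'm) groupoid_scheme \<Rightarrow> ('b, 'n) groupoid_scheme \<Rightarrow> bool" where
  "in_ISP A M \<longleftrightarrow> algebra A \<and>
     (\<exists>(I :: ('a \<Rightarrow> 'b) set) (B :: (('a \<Rightarrow> 'b) \<Rightarrow> 'b) groupoid).
        subalgebra B (power_algebra M I) \<and> isomorphic A B)"

lemma in_ISP_I:
  fixes A :: "('a, 'm) groupoid_scheme" and M :: "('b, 'n) groupoid_scheme" and I :: "'i set"
    and B :: "('i \<Rightarrow> 'b, 'k) groupoid_scheme"
  assumes A: "algebra A" and B: "subalgebra B (power_algebra M I)" and AB: "isomorphic A B"
  shows "in_ISP A M"
proof -
  obtain h where h: "h \<in> homs A B" and bij: "bij_betw h (carrier A) (carrier B)"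
    using AB unfolding isomorphic_def by blast
  define g where "g = (\<lambda>i. \<lambda>a\<in>carrier A. h a i)"
  define J where "J = g ` I"
  define e where "e = (\<lambda>a. \<lambda>j\<in>J. j a)"
  define B' where "B' = \<lparr>carrier = e ` carrier A, app = app (power_algebra M J)\<rparr>"
  have closed: "a \<cdot>\<^bsub>A\<^esub> b \<in> carrier A" if "a \<in> carrier A" "b \<in> carrier A" for a b
    using A that by (auto simp: algebra_def)
  have hB: "h a \<in> carrier B" if "a \<in> carrier A" for a
    using h that by (auto simp: homs_def)
  have hM: "h a \<in> (\<Pi>\<^sub>E i\<in>I. carrier M)" if "a \<in> carrier A" for a
    using hB[OF that] B by (auto simp: subalgebra_def power_algebra_def)
  have happ: "h (a \<cdot>\<^bsub>A\<^esub> b) i = h a i \<cdot>\<^bsub>M\<^esub> h b i"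
    if "a \<in> carrier A" "b \<in> carrier A" "i \<in> I" for a b i
  proof -
    have "h (a \<cdot>\<^bsub>A\<^esub> b) = h a \<cdot>\<^bsub>B\<^esub> h b"
      using h that by (auto simp: homs_def)
    also have "\<dots> = h a \<cdot>\<^bsub>power_algebra M I\<^esub> h b"
      using B hB that by (auto simp: subalgebra_def)
    finally show ?thesis
      using that by (simp add: power_algebra_def)
  qed
  have eM: "e a \<in> (\<Pi>\<^sub>E j\<in>J. carrier M)" if "a \<in> carrier A" for a
    using hM[OF that] that by (auto simp: e_def J_def g_def)
  have eapp: "e (a \<cdot>\<^bsub>A\<^esub> b) = e a \<cdot>\<^bsub>power_algebra M J\<^esub> e b"
    if "a \<in> carrier A" "b \<in> carrier A" for a b
    using that closed[OF that] happ[OF that]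
    by (auto simp: e_def J_def g_def power_algebra_def fun_eq_iff restrict_def)
  have inj: "inj_on e (carrier A)"
  proof (rule inj_onI)
    fix a b assume ab: "a \<in> carrier A" "b \<in> carrier A" "e a = e b"
    have "h a i = h b i" if "i \<in> I" for i
    proof -
      have "e a (g i) = e b (g i)" using ab by simp
      then show ?thesis using that ab(1,2) by (simp add: e_def J_def g_def)
    qed
    then have "h a = h b"
      using hM[OF ab(1)] hM[OF ab(2)] by (metis PiE_ext)
    then show "a = b"
      using bij ab(1,2) by (auto simp: bij_betw_def inj_on_def)
  qed
  have "algebra B'"
    using A by (force simp: algebra_def B'_def eapp[symmetric])
  then have "subalgebra B' (power_algebra M J)"
    using eM by (auto simp: subalgebra_def B'_def power_algebra_def)
  moreover have "isomorphic A B'"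
  proof -
    have "restrict e (carrier A) \<in> homs A B'"
      using closed eapp by (auto simp: homs_def B'_def)
    moreover have "bij_betw (restrict e (carrier A)) (carrier A) (carrier B')"
      using inj by (auto simp: bij_betw_def B'_def inj_on_def)
    ultimately show ?thesis unfolding isomorphic_def by blast
  qed
  ultimately show ?thesis
    using A unfolding in_ISP_def by blast
qed

section \<open>Dualizability\<close>

text \<open>A \<open>k\<close>-ary relation is a set of extensional functions on \<open>{..<k}\<close>.\<close>

definition compatible_relation ::
  "('a, 'm) groupoid_scheme \<Rightarrow> nat \<Rightarrow> (nat \<Rightarrow> 'a) set \<Rightarrow> bool" where
  "compatible_relation M k r \<longleftrightarrow> k \<ge> 1 \<and> subuniverse r (power_algebra M {..<k})"

definition hom_space ::
  "('a, 'm) groupoid_scheme \<Rightarrow> ('b, 'n) groupoid_scheme \<Rightarrow> ('a \<Rightarrow> 'b) topology" where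
  "hom_space A M =
     subtopology (product_topology (\<lambda>_. discrete_topology (carrier M)) (carrier A)) (homs A M)"

definition preserves_relation ::
  "('a, 'm) groupoid_scheme \<Rightarrow> ('b, 'n) groupoid_scheme \<Rightarrow> nat \<Rightarrow> (nat \<Rightarrow> 'b) set \<Rightarrow>
   (('a \<Rightarrow> 'b) \<Rightarrow> 'b) \<Rightarrow> bool" where
  "preserves_relation A M k r f \<longleftrightarrow>
     (\<forall>x. (\<forall>i<k. x i \<in> homs A M) \<and> (\<forall>a\<in>carrier A. (\<lambda>i\<in>{..<k}. x i a) \<in> r)
        \<longrightarrow> (\<lambda>i\<in>{..<k}. f (x i)) \<in> r)"

definition evaluation ::
  "('a, 'm) groupoid_scheme \<Rightarrow> ('b, 'n) groupoid_scheme \<Rightarrow> (('a \<Rightarrow> 'b) \<Rightarrow> 'b) \<Rightarrow> bool" where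
  "evaluation A M f \<longleftrightarrow> (\<exists>a\<in>carrier A. \<forall>x\<in>homs A M. f x = x a)"

text \<open>HOL cannot quantify over algebras of all types, so an infinite type \<open>'u\<close> plays the role
  of the universe in which the algebras live: \<open>M\<close>, its finite extensions and
  the members of its class \<open>\<I>\<S>\<P>(M)\<close> are all carried by subsets of \<open>'u\<close>. Up to isomorphism
  over \<open>M\<close> this covers every finite extension of a finite \<open>M\<close>, and every member of
  the class that is no larger than \<open>'u\<close>. An algebra failing dualizability in some \<open>'u\<close>
  fails it outright.\<close>

definition dualizable :: "'u::infinite groupoid \<Rightarrow> bool" where
  "dualizable M \<longleftrightarrow>
     (\<forall>A :: 'u groupoid. in_ISP A M \<longrightarrow>
       (\<forall>f. continuous_map (hom_space A M) (discrete_topology (carrier M)) f \<and>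
            (\<forall>k r. compatible_relation M k r \<longrightarrow> preserves_relation A M k r f)
          \<longrightarrow> evaluation A M f))"

definition inherently_non_dualizable :: "'u::infinite groupoid \<Rightarrow> bool" where
  "inherently_non_dualizable M \<longleftrightarrow>
     (\<forall>N :: 'u groupoid. algebra N \<and> finite (carrier N) \<and> subalgebra M N \<longrightarrow> \<not> dualizable N)"

section \<open>Automatic algebras\<close>

text \<open>The letter \<open>a\<close> acts as the partial map that sends \<open>q\<close> to \<open>q \<cdot> a\<close> and is
  undefined at \<open>q\<close> if \<open>q \<cdot> a = z\<close>, where \<open>z\<close> is the zero element.\<close>

definition automatic_algebra :: "'a groupoid \<Rightarrow> 'a set \<Rightarrow> 'a set \<Rightarrow> 'a \<Rightarrow> bool" where
  "automatic_algebra M Q \<Sigma> z \<longleftrightarrow>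
     carrier M = Q \<union> \<Sigma> \<union> {z} \<and> Q \<inter> \<Sigma> = {} \<and> z \<notin> Q \<union> \<Sigma> \<and>
     (\<forall>q\<in>Q. \<forall>a\<in>\<Sigma>. q \<cdot>\<^bsub>M\<^esub> a \<in> Q \<union> {z}) \<and>
     (\<forall>u\<in>carrier M. \<forall>v\<in>carrier M. \<not> (u \<in> Q \<and> v \<in> \<Sigma>) \<longrightarrow> u \<cdot>\<^bsub>M\<^esub> v = z)"

definition letter_dom :: "'a groupoid \<Rightarrow> 'a set \<Rightarrow> 'a \<Rightarrow> 'a \<Rightarrow> 'a set" where
  "letter_dom M Q z a = {q \<in> Q. q \<cdot>\<^bsub>M\<^esub> a \<noteq> z}"

definition letter_ran :: "'a groupoid \<Rightarrow> 'a set \<Rightarrow> 'a \<Rightarrow> 'a \<Rightarrow> 'a set" where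
  "letter_ran M Q z a = (\<lambda>q. q \<cdot>\<^bsub>M\<^esub> a) ` letter_dom M Q z a"

definition letter_kill :: "'a groupoid \<Rightarrow> 'a set \<Rightarrow> 'a \<Rightarrow> 'a \<Rightarrow> 'a set" where
  "letter_kill M Q z a = Q - letter_dom M Q z a"

definition word_app :: "'a groupoid \<Rightarrow> 'a \<Rightarrow> 'a list \<Rightarrow> 'a" where
  "word_app M q w = foldl (app M) q w"

end

theory Submission
  imports Defs
begin

text \<open>
  Non-dualizability comes from a ghost element. Inside a power of \<open>M\<close> take a countable subuniverse
  \<open>B\<close> with a sequence \<open>c\<^sub>0, c\<^sub>1, \<dots>\<close> in \<open>B\<close> that converges pointwise to a tuple \<open>g\<close> outside \<open>B\<close>. If every
  homomorphism from \<open>B\<close> to a finite algebra \<open>N\<close> is constant on the sequence up to a number of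
  exceptions that is bounded in terms of \<open>N\<close> alone, then sending a homomorphism to its majority value
  on the sequence is a continuous map that preserves all relations; evaluating it at the
  projections shows that only \<open>g\<close> could represent it. As \<open>N\<close> is arbitrary, this works for every finite
  extension of \<open>M\<close> (\<open>inherently_non_dualizable_if_ghost\<close>). What matters about a homomorphism is only
  that it colours \<open>B\<close> with finitely many colours and respects products.

  Two configurations in an automaton produce such a ghost.

  \<^item> \<open>single_use_letter\<close>: some letter can be applied to a state once but not twice. Products of three
    factors then vanish, and \<open>B\<close> can be listed completely.

  \<^item> \<open>two_states\<close>: there are states \<open>p\<close>, \<open>p'\<close> and words \<open>\<gamma>\<close>, \<open>\<delta>\<close> of the same length such that \<open>\<gamma>\<close> sends
    \<open>p\<close> to a state \<open>s\<close> and kills \<open>p'\<close>, while \<open>\<delta>\<close> sends \<open>p'\<close> to \<open>s\<close>. Here \<open>B\<close> consists of all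
    almost constant sequences that are not sequences of states. A product is a state only if its left
    factor is one, so \<open>B\<close> is closed for a trivial reason, and the constant sequence \<open>s\<close> is
    the ghost.

  Suppose that no letter is of the first kind. Then a letter that is defined at a state can be
  iterated there for ever, so its orbit is eventually periodic. This turns both conditions of
  the theorem into the second configuration. If \<open>u\<close> is killed by \<open>a\<close> but a word leads from \<open>u\<close> into the
  domain of \<open>a\<close>, then \<open>u\<close> reaches a cycle of \<open>a\<close>; take \<open>p' = u\<close>, a power of \<open>a\<close> for \<open>\<gamma>\<close>, and a suitable
  state on the orbit leading to that cycle for \<open>p\<close>. If \<open>a\<close> kills \<open>u = t a w\<close>, let \<open>b\<close> be the last letter of \<open>w\<close>. Either
  some \<open>u b\<^sup>n\<close> is in the domain of \<open>a\<close> and the previous case applies, or a late term \<open>s = u b\<^sup>n\<close>, which lies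
  on a cycle of \<open>b\<close>, is killed by \<open>a\<close>; then \<open>p = t\<close>, \<open>p' = s\<close>, \<open>\<gamma> = a w b\<^sup>n\<close> and a power of \<open>b\<close> for \<open>\<delta>\<close>
  work.
\<close>

section \<open>A criterion for inherent non-dualizability\<close>

text \<open>The kernel of the colouring \<open>\<phi>\<close> is a congruence on the subuniverse \<open>B\<close> of \<open>P\<close>. Speaking of
  colourings keeps the finite target algebra out of the constructions.\<close>

definition respects_app :: "('a, 'm) groupoid_scheme \<Rightarrow> 'a set \<Rightarrow> ('a \<Rightarrow> 'b) \<Rightarrow> bool" where
  "respects_app P B \<phi> \<longleftrightarrow>
     (\<forall>a\<in>B. \<forall>a'\<in>B. \<forall>b\<in>B. \<forall>b'\<in>B. \<phi> a = \<phi> a' \<longrightarrow> \<phi> b = \<phi> b' \<longrightarrow>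
        \<phi> (a \<cdot>\<^bsub>P\<^esub> b) = \<phi> (a' \<cdot>\<^bsub>P\<^esub> b'))"

lemma topspace_hom_space: "topspace (hom_space A N) = homs A N"
  by (auto simp: hom_space_def homs_def)

lemma openin_hom_space_fibre:
  assumes a: "a \<in> carrier A" and v: "v \<in> carrier N"
  shows "openin (hom_space A N) {\<phi> \<in> homs A N. \<phi> a = v}"
proof -
  have "continuous_map (hom_space A N) (discrete_topology (carrier N)) (\<lambda>\<phi>. \<phi> a)"
    unfolding hom_space_def
    by (rule continuous_map_from_subtopology, rule continuous_map_product_projection[OF a])
  then have "openin (hom_space A N) {\<phi> \<in> topspace (hom_space A N). \<phi> a \<in> {v}}"
    by (rule openin_continuous_map_preimage) (use v in auto)
  then show ?thesis by (simp add: topspace_hom_space)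
qed

text \<open>The majority value of a homomorphism on the sequence \<open>c\<close> is determined by finitely many terms,
  hence depends continuously on the homomorphism. Finitely many homomorphisms attain their majority
  values simultaneously at some term, hence every relation is preserved. The last
  hypothesis says that no element of \<open>A\<close> has all the majority values.\<close>

lemma not_dualizable_if_ghost:
  fixes N A :: "'u::infinite groupoid" and c :: "nat \<Rightarrow> 'u"
  assumes A: "in_ISP A N"
    and c: "\<And>n. c n \<in> carrier A"
    and bound: "\<And>\<phi>. \<phi> \<in> homs A N \<Longrightarrow>
      \<exists>v. finite {n. \<phi> (c n) \<noteq> v} \<and> card {n. \<phi> (c n) \<noteq> v} \<le> k"
    and ghost: "\<And>a. a \<in> carrier A \<Longrightarrow> \<exists>\<phi>\<in>homs A N. infinite {n. \<phi> (c n) \<noteq> \<phi> a}"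
  shows "\<not> dualizable N"
proof
  assume dual: "dualizable N"
  define f where "f \<phi> = (SOME v. finite {n. \<phi> (c n) \<noteq> v} \<and> card {n. \<phi> (c n) \<noteq> v} \<le> k)"
    for \<phi> :: "'u \<Rightarrow> 'u"
  have fin: "finite {n. \<phi> (c n) \<noteq> f \<phi>}" and card: "card {n. \<phi> (c n) \<noteq> f \<phi>} \<le> k"
    if "\<phi> \<in> homs A N" for \<phi>
    using someI_ex[OF bound[OF that]] unfolding f_def by auto
  have val: "\<phi> (c n) \<in> carrier N" if "\<phi> \<in> homs A N" for \<phi> n
    using that c by (auto simp: homs_def)
  have f_val: "f \<phi> \<in> carrier N" if \<phi>: "\<phi> \<in> homs A N" for \<phi>
  proof -
    obtain n where "n \<notin> {n. \<phi> (c n) \<noteq> f \<phi>}"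
      using ex_new_if_finite[OF infinite_UNIV_nat fin[OF \<phi>]] by blast
    then show ?thesis using val[OF \<phi>, of n] by simp
  qed
  \<comment> \<open>Among \<open>2 * k + 1\<close> terms at most \<open>k\<close> miss the limit value, so these terms determine it.\<close>
  have local_f: "f \<psi> = f \<phi>"
    if \<phi>: "\<phi> \<in> homs A N" and \<psi>: "\<psi> \<in> homs A N"
      and eq: "\<And>n. n \<le> 2 * k \<Longrightarrow> \<psi> (c n) = \<phi> (c n)" for \<phi> \<psi>
  proof (rule ccontr)
    assume ne: "f \<psi> \<noteq> f \<phi>"
    have "{..2 * k} \<subseteq> {n. \<phi> (c n) \<noteq> f \<phi>} \<union> {n. \<psi> (c n) \<noteq> f \<psi>}"
      using eq ne by fastforce
    then have "card {..2 * k} \<le> card ({n. \<phi> (c n) \<noteq> f \<phi>} \<union> {n. \<psi> (c n) \<noteq> f \<psi>})"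
      using fin[OF \<phi>] fin[OF \<psi>] by (intro card_mono) auto
    also have "\<dots> \<le> k + k"
      using card_Un_le card[OF \<phi>] card[OF \<psi>] by (meson add_mono order_trans)
    finally show False by simp
  qed
  have "continuous_map (hom_space A N) (discrete_topology (carrier N)) f"
    unfolding continuous_map_def
  proof (intro conjI allI impI)
    show "f \<in> topspace (hom_space A N) \<rightarrow> topspace (discrete_topology (carrier N))"
      using f_val by (auto simp: topspace_hom_space)
    fix U
    show "openin (hom_space A N) {\<phi> \<in> topspace (hom_space A N). f \<phi> \<in> U}"
    proof (subst openin_subopen, intro ballI)
      fix \<phi> assume "\<phi> \<in> {\<phi> \<in> topspace (hom_space A N). f \<phi> \<in> U}"
      then have \<phi>: "\<phi> \<in> homs A N" and U: "f \<phi> \<in> U"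
        by (auto simp: topspace_hom_space)
      define T where "T = (\<Inter>n\<in>{..2 * k}. {\<psi> \<in> homs A N. \<psi> (c n) = \<phi> (c n)})"
      have "openin (hom_space A N) T"
        unfolding T_def
        by (intro openin_INT2 openin_hom_space_fibre c val[OF \<phi>]) auto
      moreover have "\<phi> \<in> T" using \<phi> by (auto simp: T_def)
      moreover have "T \<subseteq> {\<phi> \<in> topspace (hom_space A N). f \<phi> \<in> U}"
      proof
        fix \<psi> assume "\<psi> \<in> T"
        then have "\<psi> \<in> homs A N" "\<And>n. n \<le> 2 * k \<Longrightarrow> \<psi> (c n) = \<phi> (c n)"
          by (auto simp: T_def)
        then show "\<psi> \<in> {\<phi> \<in> topspace (hom_space A N). f \<phi> \<in> U}"
          using local_f[OF \<phi>, of \<psi>] U by (auto simp: topspace_hom_space)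
      qed
      ultimately show "\<exists>T. openin (hom_space A N) T \<and> \<phi> \<in> T \<and>
          T \<subseteq> {\<phi> \<in> topspace (hom_space A N). f \<phi> \<in> U}"
        by blast
    qed
  qed
  moreover have "preserves_relation A N m r f" for m r
    unfolding preserves_relation_def
  proof (intro allI impI)
    fix x assume x: "(\<forall>i<m. x i \<in> homs A N) \<and> (\<forall>a\<in>carrier A. (\<lambda>i\<in>{..<m}. x i a) \<in> r)"
    have "finite (\<Union>i<m. {n. x i (c n) \<noteq> f (x i)})"
      using x fin by auto
    then obtain n where "n \<notin> (\<Union>i<m. {n. x i (c n) \<noteq> f (x i)})"
      using ex_new_if_finite[OF infinite_UNIV_nat] by blast
    then have "(\<lambda>i\<in>{..<m}. f (x i)) = (\<lambda>i\<in>{..<m}. x i (c n))"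
      by (auto simp: restrict_def)
    then show "(\<lambda>i\<in>{..<m}. f (x i)) \<in> r"
      using x c[of n] by simp
  qed
  ultimately obtain a where a: "a \<in> carrier A" and ev: "\<forall>\<phi>\<in>homs A N. f \<phi> = \<phi> a"
    using dual A unfolding dualizable_def evaluation_def by blast
  obtain \<phi> where "\<phi> \<in> homs A N" "infinite {n. \<phi> (c n) \<noteq> \<phi> a}"
    using ghost[OF a] by blast
  then show False
    using fin[of \<phi>] ev by simp
qed

text \<open>The subuniverse \<open>B\<close> of a power of \<open>M\<close> is also one of the same power of any extension \<open>N\<close>. It is
  countable so that a copy of it fits into the type \<open>'u\<close>. The projections are
  homomorphisms whose majority values spell out \<open>g\<close>.\<close>

lemma inherently_non_dualizable_if_ghost:
  fixes M :: "'u::infinite groupoid" and I :: "'i set" and B :: "('i \<Rightarrow> 'u) set"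
    and c :: "nat \<Rightarrow> 'i \<Rightarrow> 'u" and g :: "'i \<Rightarrow> 'u"
  assumes B: "subuniverse B (power_algebra M I)" and "countable B"
    and c: "\<And>n. c n \<in> B"
    and g: "g \<in> extensional I" "g \<notin> B"
    and lim: "\<And>i. i \<in> I \<Longrightarrow> finite {n. c n i \<noteq> g i}"
    and bound: "\<And>(\<phi> :: ('i \<Rightarrow> 'u) \<Rightarrow> 'u) C. finite C \<Longrightarrow> \<phi> ` B \<subseteq> C \<Longrightarrow>
      respects_app (power_algebra M I) B \<phi> \<Longrightarrow>
      \<exists>v. finite {n. \<phi> (c n) \<noteq> v} \<and> card {n. \<phi> (c n) \<noteq> v} \<le> card C"
  shows "inherently_non_dualizable M"
  unfolding inherently_non_dualizable_def
proof (intro allI impI, elim conjE)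
  fix N :: "'u groupoid"
  assume N: "algebra N" "finite (carrier N)" "subalgebra M N"
  let ?P = "power_algebra M I"
  obtain h :: "nat \<Rightarrow> 'u" where h: "inj h"
    using infinite_countable_subset[OF infinite_UNIV] by blast
  define enc where "enc = h \<circ> to_nat_on B"
  have inj: "inj_on enc B"
    unfolding enc_def using \<open>countable B\<close> h
    by (meson comp_inj_on inj_on_subset inj_on_to_nat_on subset_UNIV)
  define dec where "dec = inv_into B enc"
  have dec_enc [simp]: "dec (enc b) = b" if "b \<in> B" for b
    using inj that by (simp add: dec_def)
  define A where "A = \<lparr>carrier = enc ` B, app = (\<lambda>x y. enc (dec x \<cdot>\<^bsub>?P\<^esub> dec y))\<rparr>"
  have BP: "b \<in> (\<Pi>\<^sub>E i\<in>I. carrier M)" if "b \<in> B" for b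
    using B that by (auto simp: subuniverse_def power_algebra_def)
  have closed: "b \<cdot>\<^bsub>?P\<^esub> b' \<in> B" if "b \<in> B" "b' \<in> B" for b b'
    using B that by (auto simp: subuniverse_def)
  have MN: "x \<cdot>\<^bsub>M\<^esub> y = x \<cdot>\<^bsub>N\<^esub> y"
    if "x \<in> carrier M" "y \<in> carrier M" for x y
    using N(3) that by (auto simp: subalgebra_def)
  have MN_sub: "carrier M \<subseteq> carrier N"
    using N(3) by (simp add: subalgebra_def)
  have app_N: "b \<cdot>\<^bsub>?P\<^esub> b' = b \<cdot>\<^bsub>power_algebra N I\<^esub> b'" if "b \<in> B" "b' \<in> B" for b b'
    using BP[OF that(1)] BP[OF that(2)] MN
    by (auto simp: power_algebra_def fun_eq_iff restrict_def)
  have alg_A: "algebra A"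
    using closed c by (auto simp: algebra_def A_def)
  have "in_ISP A N"
  proof (rule in_ISP_I[OF alg_A])
    show "subalgebra \<lparr>carrier = B, app = app ?P\<rparr> (power_algebra N I)"
      unfolding subalgebra_def
    proof (intro conjI ballI)
      show "algebra \<lparr>carrier = B, app = app ?P\<rparr>"
        using closed c by (auto simp: algebra_def)
      have "b \<in> (\<Pi>\<^sub>E i\<in>I. carrier N)" if "b \<in> B" for b
        using BP[OF that] MN_sub PiE_mono by blast
      then show "carrier \<lparr>carrier = B, app = app ?P\<rparr> \<subseteq> carrier (power_algebra N I)"
        by (auto simp: power_algebra_def)
    qed (simp add: app_N)
    have "restrict dec (carrier A) \<in> homs A \<lparr>carrier = B, app = app ?P\<rparr>"
      using closed by (auto simp: homs_def A_def)
    moreover have "dec ` enc ` B = B"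
      by (force simp: image_image)
    then have "bij_betw (restrict dec (carrier A)) (carrier A) B"
      by (auto simp: bij_betw_def inj_on_def A_def)
    ultimately show "isomorphic A \<lparr>carrier = B, app = app ?P\<rparr>"
      unfolding isomorphic_def by (intro bexI[of _ "restrict dec (carrier A)"]) simp_all
  qed
  then show "\<not> dualizable N"
  proof (rule not_dualizable_if_ghost)
    show "enc (c n) \<in> carrier A" for n
      using c by (simp add: A_def)
    show "\<exists>v. finite {n. \<phi> (enc (c n)) \<noteq> v} \<and> card {n. \<phi> (enc (c n)) \<noteq> v} \<le> card (carrier N)"
      if \<phi>: "\<phi> \<in> homs A N" for \<phi>
    proof -
      have hom: "\<phi> (enc (a \<cdot>\<^bsub>?P\<^esub> b)) = \<phi> (enc a) \<cdot>\<^bsub>N\<^esub> \<phi> (enc b)" if "a \<in> B" "b \<in> B" for a b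
      proof -
        have "\<phi> (enc a \<cdot>\<^bsub>A\<^esub> enc b) = \<phi> (enc a) \<cdot>\<^bsub>N\<^esub> \<phi> (enc b)"
          using \<phi> that by (auto simp: homs_def A_def)
        then show ?thesis using that by (simp add: A_def)
      qed
      have "(\<phi> \<circ> enc) ` B \<subseteq> carrier N"
        using \<phi> by (auto simp: homs_def A_def)
      moreover have "respects_app ?P B (\<phi> \<circ> enc)"
        unfolding respects_app_def comp_apply by (metis hom)
      ultimately show ?thesis
        using bound[OF N(2), of "\<phi> \<circ> enc"] by (simp add: comp_def)
    qed
    \<comment> \<open>An element of \<open>B\<close> differs from \<open>g\<close> at some coordinate; the projection there separates it from
      the sequence.\<close>
    show "\<exists>\<phi>\<in>homs A N. infinite {n. \<phi> (enc (c n)) \<noteq> \<phi> a}" if a: "a \<in> carrier A" for a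
    proof -
      obtain b where b: "b \<in> B" "a = enc b"
        using a by (auto simp: A_def)
      have "b \<noteq> g" using g(2) b(1) by blast
      moreover have "b \<in> extensional I" using BP[OF b(1)] by (simp add: PiE_def)
      ultimately obtain i where i: "i \<in> I" "b i \<noteq> g i"
        using g(1) by (metis extensionalityI)
      let ?\<rho> = "\<lambda>a\<in>carrier A. dec a i"
      have bM: "b i \<in> carrier M" if "b \<in> B" for b
        using BP[OF that] i(1) by auto
      have "(b \<cdot>\<^bsub>?P\<^esub> b') i = b i \<cdot>\<^bsub>N\<^esub> b' i" if "b \<in> B" "b' \<in> B" for b b'
        using MN[OF bM bM] that i(1) by (simp add: power_algebra_def)
      then have "?\<rho> \<in> homs A N"
        using bM MN_sub closed by (auto simp: homs_def A_def)
      moreover have "infinite {n. c n i \<noteq> b i}"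
      proof
        assume "finite {n. c n i \<noteq> b i}"
        then have "finite ({n. c n i \<noteq> b i} \<union> {n. c n i \<noteq> g i})"
          using lim[OF i(1)] by blast
        moreover have "{n. c n i \<noteq> b i} \<union> {n. c n i \<noteq> g i} = UNIV"
          using i(2) by auto
        ultimately show False by simp
      qed
      then have "infinite {n. ?\<rho> (enc (c n)) \<noteq> ?\<rho> a}"
        using c b by (simp add: A_def)
      ultimately show ?thesis by blast
    qed
  qed
qed

section \<open>Computing in an automatic algebra\<close>

locale finite_automatic =
  fixes M :: "'u::infinite groupoid" and Q \<Sigma> :: "'u set" and z :: 'u
  assumes automatic: "automatic_algebra M Q \<Sigma> z"
    and finite_carrier: "finite (carrier M)"
begin

lemma carrier_eq: "carrier M = Q \<union> \<Sigma> \<union> {z}"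
  using automatic by (simp add: automatic_algebra_def)

lemma state_not_letter: "q \<in> Q \<Longrightarrow> q \<notin> \<Sigma>" and zero_not_state: "z \<notin> Q"
  and zero_not_letter: "z \<notin> \<Sigma>"
  using automatic by (auto simp: automatic_algebra_def)

lemma state_letter: "q \<in> Q \<Longrightarrow> a \<in> \<Sigma> \<Longrightarrow> q \<cdot>\<^bsub>M\<^esub> a \<in> Q \<union> {z}"
  using automatic by (simp add: automatic_algebra_def)

lemma app_zero: "u \<in> carrier M \<Longrightarrow> v \<in> carrier M \<Longrightarrow> u \<notin> Q \<or> v \<notin> \<Sigma> \<Longrightarrow> u \<cdot>\<^bsub>M\<^esub> v = z"
  using automatic by (auto simp: automatic_algebra_def)

lemma app_closed: "u \<in> carrier M \<Longrightarrow> v \<in> carrier M \<Longrightarrow> u \<cdot>\<^bsub>M\<^esub> v \<in> carrier M"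
  using app_zero[of u v] state_letter[of u v] carrier_eq by fastforce

lemma zero_app: "v \<in> carrier M \<Longrightarrow> z \<cdot>\<^bsub>M\<^esub> v = z"
  using app_zero[of z v] carrier_eq zero_not_state by simp

lemma app_state_imp: "u \<in> carrier M \<Longrightarrow> v \<in> carrier M \<Longrightarrow> u \<cdot>\<^bsub>M\<^esub> v \<in> Q \<Longrightarrow> u \<in> Q"
  using app_zero[of u v] zero_not_state by metis

lemma word_app_Nil [simp]: "word_app M q [] = q"
  and word_app_Cons [simp]: "word_app M q (a # w) = word_app M (q \<cdot>\<^bsub>M\<^esub> a) w"
  and word_app_append: "word_app M q (v @ w) = word_app M (word_app M q v) w"
  by (simp_all add: word_app_def)

lemma zero_word: "set w \<subseteq> carrier M \<Longrightarrow> word_app M z w = z"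
  by (induction w) (auto simp: zero_app)

lemma lists_carrier: "w \<in> lists \<Sigma> \<Longrightarrow> set w \<subseteq> carrier M"
  using carrier_eq by auto

lemma state_word: "q \<in> Q \<Longrightarrow> w \<in> lists \<Sigma> \<Longrightarrow> word_app M q w \<in> Q \<union> {z}"
proof (induction w arbitrary: q)
  case (Cons a w)
  then consider "q \<cdot>\<^bsub>M\<^esub> a \<in> Q" | "q \<cdot>\<^bsub>M\<^esub> a = z"
    using state_letter[of q a] by auto
  then show ?case
    using Cons zero_word[OF lists_carrier] by cases auto
qed auto

lemma word_state_prefix:
  assumes "q \<in> Q" "v \<in> lists \<Sigma>" "w \<in> lists \<Sigma>" "word_app M q (v @ w) \<in> Q"
  shows "word_app M q v \<in> Q"
  using state_word[OF assms(1,2)] assms zero_not_state zero_word[OF lists_carrier, of w]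
  by (auto simp: word_app_append)

section \<open>A letter that cannot be used twice\<close>

text \<open>These are the indices that share their colour with no other index.\<close>

lemma exceptional_bound:
  fixes r :: "nat \<Rightarrow> 'c"
  assumes "finite C" "range r \<subseteq> C"
  shows "finite {n. \<forall>m. r m = r n \<longrightarrow> m = n}" "card {n. \<forall>m. r m = r n \<longrightarrow> m = n} \<le> card C"
proof -
  have inj: "inj_on r {n. \<forall>m. r m = r n \<longrightarrow> m = n}" by (auto simp: inj_on_def)
  have sub: "r ` {n. \<forall>m. r m = r n \<longrightarrow> m = n} \<subseteq> C" using assms(2) by blast
  show "finite {n. \<forall>m. r m = r n \<longrightarrow> m = n}"
    using inj_on_finite[OF inj sub assms(1)] .
  show "card {n. \<forall>m. r m = r n \<longrightarrow> m = n} \<le> card C"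
    using card_inj_on_le[OF inj sub assms(1)] .
qed

text \<open>
  Coordinates are sets of natural numbers. The state tuple \<open>t x\<close> and the letter tuple \<open>l F\<close> are nonzero
  together only at \<open>{}\<close> and at one further coordinate, namely \<open>{x}\<close> if \<open>x \<notin> F\<close> and \<open>F\<close> if \<open>x \<in> F\<close>; so
  \<open>t x l F\<close> is \<open>m {x}\<close> or \<open>m F\<close>. Since the letter kills \<open>q\<close>, all other products are zero. So no tuple in
  \<open>B\<close> is \<open>q\<close> at \<open>{}\<close> and zero elsewhere; this tuple, \<open>m {}\<close>, is the ghost.

  For the linking, suppose that \<open>t x\<close>, \<open>t x'\<close> have the same colour and so do \<open>t y\<close>, \<open>t y'\<close>. With
  \<open>F = {x', y'}\<close>, multiplication by \<open>l F\<close> gives \<open>m {x}\<close> the colour of \<open>m F\<close>, and \<open>m {y}\<close> as well. The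
  exceptions are the indices whose colour is not repeated, at most one for each colour.
\<close>

lemma single_use_letter:
  assumes p: "p \<in> Q" and a: "a \<in> \<Sigma>" and pa: "p \<cdot>\<^bsub>M\<^esub> a \<noteq> z" and paa: "p \<cdot>\<^bsub>M\<^esub> a \<cdot>\<^bsub>M\<^esub> a = z"
  shows "inherently_non_dualizable M"
proof -
  define q where "q = p \<cdot>\<^bsub>M\<^esub> a"
  have q: "q \<in> Q" using state_letter[OF p a] pa by (auto simp: q_def)
  have pq: "p \<noteq> q" using pa paa by (auto simp: q_def)
  define t where "t x = (\<lambda>i :: nat set. if i = {} \<or> x \<in> i then p else z)" for x
  define l where "l F = (\<lambda>i :: nat set. if i = {} \<or> i = F \<or> (\<exists>y. i = {y} \<and> y \<notin> F) then a else z)"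
    for F
  define m where "m F = (\<lambda>i :: nat set. if i = {} \<or> i = F then q else z)" for F
  define nul where "nul = (\<lambda>i :: nat set. z)"
  define \<F> where "\<F> = {F :: nat set. finite F}"
  define B where "B = range t \<union> l ` \<F> \<union> m ` (\<F> - {{}}) \<union> {nul}"
  let ?P = "power_algebra M (UNIV :: nat set set)"
  have P: "x \<cdot>\<^bsub>?P\<^esub> y = (\<lambda>i. x i \<cdot>\<^bsub>M\<^esub> y i)" for x y
    by (simp add: power_algebra_def restrict_def)
  have cM: "p \<in> carrier M" "q \<in> carrier M" "a \<in> carrier M" "z \<in> carrier M"
    using p q a carrier_eq by auto
  have letters: "a \<notin> Q" "p \<notin> \<Sigma>" "q \<notin> \<Sigma>" "z \<notin> Q" "z \<notin> \<Sigma>"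
    using p q a state_not_letter zero_not_state zero_not_letter by auto
  have ne: "p \<noteq> q" "p \<noteq> a" "p \<noteq> z" "q \<noteq> a" "q \<noteq> z" "a \<noteq> z"
    using pq p q a letters by auto
  have app_z: "u \<cdot>\<^bsub>M\<^esub> v = z" if "u \<in> {p, q, a, z}" "v \<in> {p, q, a, z}" "\<not> (u = p \<and> v = a)" for u v
  proof (cases "u \<in> Q \<and> v \<in> \<Sigma>")
    case True
    then have "u = q" "v = a" using that letters by auto
    then show ?thesis using paa by (simp add: q_def)
  next
    case False
    then show ?thesis using that(1,2) cM by (intro app_zero) auto
  qed
  have t_l: "t x \<cdot>\<^bsub>?P\<^esub> l F = m (if x \<in> F then F else {x})" for x F
    unfolding P
  proof
    fix i
    have "p \<cdot>\<^bsub>M\<^esub> a = q" "p \<cdot>\<^bsub>M\<^esub> z = z" "z \<cdot>\<^bsub>M\<^esub> a = z" "z \<cdot>\<^bsub>M\<^esub> z = z"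
      using ne app_z[of p z] app_z[of z a] app_z[of z z] by (simp_all add: q_def)
    then show "t x i \<cdot>\<^bsub>M\<^esub> l F i = m (if x \<in> F then F else {x}) i"
      by (auto simp: t_def l_def m_def)
  qed
  have B_cases: "(\<exists>x. b = t x) \<or> (\<exists>F\<in>\<F>. b = l F) \<or> (\<exists>F\<in>\<F> - {{}}. b = m F) \<or> b = nul"
    if "b \<in> B" for b using that by (auto simp: B_def)
  have m_B: "m F \<in> B" if "finite F" "F \<noteq> {}" for F
    using that by (simp add: B_def \<F>_def)
  have val_B: "b i \<in> {p, q, a, z}" if "b \<in> B" for b i
    using B_cases[OF that] by (elim disjE exE bexE) (simp_all add: t_def l_def m_def nul_def)
  have only_t: "b \<in> range t" if "b \<in> B" "b i = p" for b i
    using B_cases[OF that(1)] that(2) ne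
    by (elim disjE exE bexE) (auto simp: l_def m_def nul_def split: if_splits)
  have only_l: "b \<in> l ` \<F>" if "b \<in> B" "b i = a" for b i
    using B_cases[OF that(1)] that(2) ne
    by (elim disjE exE bexE) (auto simp: t_def m_def nul_def split: if_splits)
  have nul: "b \<cdot>\<^bsub>?P\<^esub> b' = nul" if b: "b \<in> B" "b' \<in> B" "b \<notin> range t \<or> b' \<notin> l ` \<F>" for b b'
  proof -
    have "b i \<cdot>\<^bsub>M\<^esub> b' i = z" for i
      by (rule app_z[OF val_B[OF b(1)] val_B[OF b(2)]]) (use only_t[OF b(1)] only_l[OF b(2)] b(3) in blast)
    then show ?thesis by (simp add: P nul_def)
  qed
  show ?thesis
  proof (rule inherently_non_dualizable_if_ghost)
    show "subuniverse B ?P"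
      unfolding subuniverse_def
    proof (intro conjI ballI)
      show "B \<subseteq> carrier ?P"
        using val_B cM by (fastforce simp: power_algebra_def)
      fix b b' assume b: "b \<in> B" "b' \<in> B"
      show "b \<cdot>\<^bsub>?P\<^esub> b' \<in> B"
      proof (cases "b \<in> range t \<and> b' \<in> l ` \<F>")
        case True
        then obtain x F where "b = t x" "b' = l F" "finite F" by (auto simp: \<F>_def)
        then show ?thesis using m_B[of F] m_B[of "{x}"] by (cases "x \<in> F") (auto simp: t_l)
      next
        case False
        then show ?thesis using nul[OF b] by (auto simp: B_def)
      qed
    qed
    have "countable \<F>"
      unfolding \<F>_def by (rule countable_Collect_finite)
    then show "countable B" by (auto simp: B_def)
    show "m {x} \<in> B" for x by (rule m_B) simp_all
    show "m {} \<notin> B"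
    proof
      assume "m {} \<in> B"
      from B_cases[OF this] show False
      proof (elim disjE exE bexE)
        show False if "m {} = t x" for x
          using fun_cong[OF that, of "{}"] ne by (simp add: m_def t_def)
        show False if "m {} = l F" for F
          using fun_cong[OF that, of "{}"] ne by (simp add: m_def l_def)
        show False if "F \<in> \<F> - {{}}" "m {} = m F" for F
          using fun_cong[OF that(2), of F] that(1) ne by (simp add: m_def)
        show False if "m {} = nul"
          using fun_cong[OF that, of "{}"] ne by (simp add: m_def nul_def)
      qed
    qed
    show "finite {n. m {n} i \<noteq> m {} i}" for i
    proof (rule finite_subset)
      show "{n. m {n} i \<noteq> m {} i} \<subseteq> {n. i = {n}}" by (auto simp: m_def)
      show "finite {n. i = {n}}" by (cases "\<exists>n. i = {n}") auto
    qed
    fix \<phi> :: "(nat set \<Rightarrow> 'u) \<Rightarrow> 'u" and C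
    assume C: "finite C" "\<phi> ` B \<subseteq> C" and \<phi>: "respects_app ?P B \<phi>"
    have cong: "\<phi> (t x \<cdot>\<^bsub>?P\<^esub> l F) = \<phi> (t y \<cdot>\<^bsub>?P\<^esub> l F)" if "\<phi> (t x) = \<phi> (t y)" "finite F" for x y F
    proof -
      have "t x \<in> B" "t y \<in> B" "l F \<in> B" using that(2) by (simp_all add: B_def \<F>_def)
      then show ?thesis using \<phi> that(1) unfolding respects_app_def by blast
    qed
    define E where "E = {n. \<forall>k. \<phi> (t k) = \<phi> (t n) \<longrightarrow> k = n}"
    have "range (\<lambda>n. \<phi> (t n)) \<subseteq> C" using C(2) unfolding B_def by blast
    note E = exceptional_bound[OF C(1) this, folded E_def]
    have link: "\<phi> (m {x}) = \<phi> (m {y})" if "x \<notin> E" "y \<notin> E" for x y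
    proof (cases "\<phi> (t x) = \<phi> (t y)")
      case True
      then show ?thesis using cong[of x y "{}"] by (simp add: t_l)
    next
      case False
      obtain x' y' where x': "\<phi> (t x') = \<phi> (t x)" "x' \<noteq> x" and y': "\<phi> (t y') = \<phi> (t y)" "y' \<noteq> y"
        using \<open>x \<notin> E\<close> \<open>y \<notin> E\<close> by (auto simp: E_def)
      \<comment> \<open>Both \<open>x\<close> and \<open>y\<close> lie outside the set \<open>F = {x', y'}\<close>, so \<open>t x l F = m {x}\<close> and \<open>t y l F = m {y}\<close>.\<close>
      have "x \<noteq> y'" "y \<noteq> x'" using False x' y' by auto
      then show ?thesis
        using cong[of x x' "{x', y'}"] cong[of y y' "{x', y'}"] x' y' by (simp add: t_l)
    qed
    obtain x where x: "x \<notin> E"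
      using ex_new_if_finite[OF infinite_UNIV_nat E(1)] by blast
    have sub: "{n. \<phi> (m {n}) \<noteq> \<phi> (m {x})} \<subseteq> E"
      using link[OF _ x] by blast
    show "\<exists>v. finite {n. \<phi> (m {n}) \<noteq> v} \<and> card {n. \<phi> (m {n}) \<noteq> v} \<le> card C"
      by (intro exI conjI, rule finite_subset[OF sub E(1)], rule order_trans[OF card_mono[OF E(1) sub] E(2)])
  qed simp
qed

section \<open>Two states that can be told apart and brought together\<close>

lemma countable_almost_constant:
  fixes C :: "'a set"
  assumes "countable C"
  shows "countable {x :: nat \<Rightarrow> 'a. range x \<subseteq> C \<and> (\<exists>v. finite {i. x i \<noteq> v})}" (is "countable ?S")
proof -
  define dec :: "'a list \<times> 'a \<Rightarrow> nat \<Rightarrow> 'a"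
    where "dec = (\<lambda>(l, v) i. if i < length l then l ! i else v)"
  have "x \<in> dec ` (lists C \<times> C)" if "x \<in> ?S" for x
  proof -
    obtain v where x: "range x \<subseteq> C" and fin: "finite {i. x i \<noteq> v}" using \<open>x \<in> ?S\<close> by blast
    then obtain m where m: "\<And>i. x i \<noteq> v \<Longrightarrow> i < m"
      using finite_nat_set_iff_bounded[of "{i. x i \<noteq> v}"] by auto
    have "x = dec (map x [0..<m], v)" using m by (auto simp: dec_def fun_eq_iff)
    moreover have "x m = v" using m by blast
    then have "(map x [0..<m], v) \<in> lists C \<times> C" using x by (auto simp: image_subset_iff)
    ultimately show ?thesis by blast
  qed
  then have "?S \<subseteq> dec ` (lists C \<times> C)" by blast
  moreover have "countable (dec ` (lists C \<times> C))" using assms by simp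
  ultimately show ?thesis by (rule countable_subset)
qed

text \<open>Some colour is used infinitely often. If \<open>G\<close> is a finite set of numbers of other colours, then
  all but finitely many \<open>x\<close> of that colour avoid the sets \<open>bad y\<close> for \<open>y \<in> G\<close>; for such \<open>x\<close> the set \<open>G\<close>
  lies in \<open>bad x\<close>, which bounds its size.\<close>

lemma almost_monochromatic:
  fixes r :: "nat \<Rightarrow> 'c" and bad :: "nat \<Rightarrow> nat set"
  assumes "finite C" "range r \<subseteq> C"
    and bad: "\<And>x. finite (bad x)" "\<And>x. card (bad x) \<le> k"
    and eq: "\<And>x y. x \<notin> bad y \<Longrightarrow> y \<notin> bad x \<Longrightarrow> r x = r y"
  shows "\<exists>v. finite {n. r n \<noteq> v} \<and> card {n. r n \<noteq> v} \<le> k"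
proof -
  have "finite (range r)" using assms(1,2) finite_subset by blast
  then obtain n0 where inf: "infinite {n. r n = r n0}"
    using pigeonhole_infinite[of UNIV r] by auto
  have "card G \<le> k" if G: "G \<subseteq> {n. r n \<noteq> r n0}" "finite G" for G
  proof -
    have "infinite ({n. r n = r n0} - (\<Union>y\<in>G. bad y))"
      using inf G(2) bad(1) by (intro Diff_infinite_finite) auto
    then obtain x where x: "r x = r n0" "\<And>y. y \<in> G \<Longrightarrow> x \<notin> bad y"
      using infinite_imp_nonempty by blast
    then have "G \<subseteq> bad x" using G(1) eq by fastforce
    then show ?thesis using card_mono[OF bad(1)] bad(2) order_trans by metis
  qed
  then show ?thesis
    using finite_if_finite_subsets_card_bdd[of "{n. r n \<noteq> r n0}" k] by blast
qed

text \<open>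
  The sequence \<open>c Z\<close> is zero on \<open>Z\<close> and \<open>s\<close> elsewhere. For each \<open>x\<close>, all but boundedly many \<open>y\<close> are such
  that \<open>c {x}\<close> and \<open>c {x, y}\<close> have the same colour; then \<open>almost_monochromatic\<close> applies. To see this, take
  more numbers \<open>y\<close> than there are colours. The sequences \<open>d k\<close> are zero at \<open>x\<close>, \<open>p'\<close> at the first \<open>k\<close> of
  the \<open>y\<close>s and \<open>p\<close> elsewhere. Two of them, with \<open>j < k\<close>, have the same colour. The words
  that read \<open>\<delta>\<close> at the first \<open>j\<close> of the \<open>y\<close>s and \<open>\<gamma>\<close> elsewhere turn \<open>d j\<close> into \<open>c {x}\<close>, whereas in \<open>d k\<close> they
  kill the \<open>y\<close>s numbered from \<open>j\<close> to \<open>k - 1\<close>. Putting zero letters at one of these numbers \<open>y\<close> makes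
  no difference for \<open>d k\<close>, but turns \<open>d j\<close> into \<open>c {x, y}\<close>.
\<close>

lemma two_states:
  assumes p: "p \<in> Q" and p': "p' \<in> Q"
    and \<gamma>: "\<gamma> \<in> lists \<Sigma>" and \<delta>: "\<delta> \<in> lists \<Sigma>" and len: "length \<gamma> = length \<delta>"
    and s: "word_app M p \<gamma> \<in> Q" and eq: "word_app M p' \<delta> = word_app M p \<gamma>"
    and kill: "word_app M p' \<gamma> = z"
  shows "inherently_non_dualizable M"
proof -
  define P where "P = power_algebra M (UNIV :: nat set)"
  have P: "x \<cdot>\<^bsub>P\<^esub> y = (\<lambda>i. x i \<cdot>\<^bsub>M\<^esub> y i)" for x y
    by (simp add: P_def power_algebra_def restrict_def)
  define s where "s = word_app M p \<gamma>"
  define B where "B = {x :: nat \<Rightarrow> 'u. range x \<subseteq> carrier M \<and> (\<exists>v. finite {i. x i \<noteq> v}) \<and> \<not> range x \<subseteq> Q}"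
  have B_I: "x \<in> B" if "\<And>i. x i \<in> carrier M" "finite {i. x i \<noteq> v}" "x j \<notin> Q" for x v j
    using that by (auto simp: B_def)
  have closed: "x \<cdot>\<^bsub>P\<^esub> y \<in> B" if x: "x \<in> B" and y: "y \<in> B" for x y
  proof -
    obtain v w j where v: "finite {i. x i \<noteq> v}" and w: "finite {i. y i \<noteq> w}" and j: "x j \<notin> Q"
      using x y by (auto simp: B_def)
    have car: "x i \<in> carrier M" "y i \<in> carrier M" for i using x y by (auto simp: B_def)
    show ?thesis
      unfolding P
    proof (rule B_I)
      show "x i \<cdot>\<^bsub>M\<^esub> y i \<in> carrier M" for i using app_closed car by blast
      show "finite {i. x i \<cdot>\<^bsub>M\<^esub> y i \<noteq> v \<cdot>\<^bsub>M\<^esub> w}"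
        by (rule finite_subset[OF _ finite_UnI[OF v w]]) auto
      show "x j \<cdot>\<^bsub>M\<^esub> y j \<notin> Q" using app_state_imp car j by blast
    qed
  qed
  define c where "c Z = (\<lambda>i :: nat. if i \<in> Z then z else s)" for Z
  have carr: "z \<in> carrier M" "s \<in> carrier M" "p \<in> carrier M" "p' \<in> carrier M"
    using carrier_eq p p' assms(6) by (auto simp: s_def)
  have c_B: "c Z \<in> B" if "finite Z" "x \<in> Z" for x Z
  proof (rule B_I)
    show "c Z i \<in> carrier M" for i using carr by (simp add: c_def)
    show "finite {i. c Z i \<noteq> s}" by (rule finite_subset[OF _ that(1)]) (auto simp: c_def)
    show "c Z x \<notin> Q" using that(2) zero_not_state by (simp add: c_def)
  qed
  show ?thesis
  proof (rule inherently_non_dualizable_if_ghost)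
    show "subuniverse B (power_algebra M UNIV)"
      using closed by (auto simp: subuniverse_def P_def[symmetric]) (auto simp: B_def P_def power_algebra_def)
    show "countable B"
      by (rule countable_subset[OF _ countable_almost_constant[of "carrier M"]])
        (use finite_carrier in \<open>auto simp: B_def countable_finite\<close>)
    show "c {x} \<in> B" for x by (rule c_B) auto
    show "(\<lambda>_. s) \<notin> B" using assms(6) by (auto simp: B_def s_def)
    show "finite {n. c {n} i \<noteq> s}" for i
      by (rule finite_subset[of _ "{i}"]) (auto simp: c_def)
    fix \<phi> :: "(nat \<Rightarrow> 'u) \<Rightarrow> 'u" and C
    assume C: "finite C" "\<phi> ` B \<subseteq> C" and resp: "respects_app (power_algebra M UNIV) B \<phi>"
    \<comment> \<open>Equal colours survive the application of a different word at each coordinate, provided that the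
      words have the same length and almost all of them are \<open>\<gamma>\<close>.\<close>
    have word_cong: "\<phi> (\<lambda>i. word_app M (d i) (W i)) = \<phi> (\<lambda>i. word_app M (d' i) (W i))"
      if d: "d \<in> B" "d' \<in> B" "\<phi> d = \<phi> d'"
        and W: "\<And>i. W i \<in> lists (insert z \<Sigma>)" "\<And>i. length (W i) = length \<gamma>" "finite {i. W i \<noteq> \<gamma>}"
      for d d' W
    proof -
      have W_B: "(\<lambda>i. W i ! m) \<in> B" if m: "m < length \<gamma>" for m
      proof (rule B_I)
        have *: "W i ! m \<in> insert z \<Sigma>" for i
          using W(1)[of i] W(2)[of i] m by (metis in_lists_conv_set nth_mem)
        then show "W i ! m \<in> carrier M" for i using carrier_eq by blast
        show "finite {i. W i ! m \<noteq> \<gamma> ! m}"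
          by (rule finite_subset[OF _ W(3)]) auto
        show "W 0 ! m \<notin> Q" using *[of 0] zero_not_state state_not_letter by blast
      qed
      let ?e = "\<lambda>d m i. word_app M (d i) (take m (W i))"
      have step: "?e d (Suc m) = ?e d m \<cdot>\<^bsub>P\<^esub> (\<lambda>i. W i ! m)" if "m < length \<gamma>" for d m
        using that W(2) by (simp add: P take_Suc_conv_app_nth word_app_append)
      have "m \<le> length \<gamma> \<Longrightarrow> ?e d m \<in> B \<and> ?e d' m \<in> B \<and> \<phi> (?e d m) = \<phi> (?e d' m)" for m
      proof (induction m)
        case 0
        then show ?case using d by simp
      next
        case (Suc m)
        then have m: "m < length \<gamma>" by simp
        note IH = Suc.IH[OF less_imp_le[OF m]]
        have "\<phi> (?e d m \<cdot>\<^bsub>P\<^esub> (\<lambda>i. W i ! m)) = \<phi> (?e d' m \<cdot>\<^bsub>P\<^esub> (\<lambda>i. W i ! m))"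
          using resp IH W_B[OF m] unfolding respects_app_def P_def by blast
        moreover have "?e d m \<cdot>\<^bsub>P\<^esub> (\<lambda>i. W i ! m) \<in> B" "?e d' m \<cdot>\<^bsub>P\<^esub> (\<lambda>i. W i ! m) \<in> B"
          using closed IH W_B[OF m] by blast+
        ultimately show ?case
          unfolding step[OF m] by blast
      qed
      from this[of "length \<gamma>"] show ?thesis using W(2) by simp
    qed
    have link: "\<exists>y\<in>Y. \<phi> (c {x, y}) = \<phi> (c {x})" if Y: "finite Y" "card Y > card C" for x Y
    proof -
      obtain h where h: "bij_betw h {0..<card Y} Y"
        using ex_bij_betw_nat_finite[OF Y(1)] by blast
      define d where "d k = (\<lambda>i. if i = x then z else if i \<in> h ` {0..<k} then p' else p)" for k
      have d_B: "d k \<in> B" for k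
      proof (rule B_I)
        show "d k i \<in> carrier M" for i using carr by (simp add: d_def)
        show "finite {i. d k i \<noteq> p}"
          by (rule finite_subset[of _ "insert x (h ` {0..<k})"]) (auto simp: d_def)
        show "d k x \<notin> Q" using zero_not_state by (simp add: d_def)
      qed
      have "\<not> inj_on (\<lambda>k. \<phi> (d k)) {0..<card Y}"
      proof
        assume "inj_on (\<lambda>k. \<phi> (d k)) {0..<card Y}"
        moreover have "(\<lambda>k. \<phi> (d k)) ` {0..<card Y} \<subseteq> C" using C(2) d_B by blast
        ultimately have "card {0..<card Y} \<le> card C" using C(1) card_inj_on_le by blast
        then show False using Y(2) by simp
      qed
      then obtain j k where jk: "j < k" "k < card Y" "\<phi> (d j) = \<phi> (d k)"
        unfolding inj_on_def by (metis atLeastLessThan_iff linorder_neqE_nat)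
      have h_inj: "h j \<notin> h ` {0..<j}"
        using inj_onD[OF bij_betw_imp_inj_on[OF h], of j] jk by fastforce
      define D where "D = insert x (h ` {0..<k} - h ` {0..<j})"
      have hj: "h j \<in> D" "h j \<in> Y"
        using jk bij_betwE[OF h] h_inj by (simp_all add: D_def)
      have sub: "h ` {0..<j} \<subseteq> h ` {0..<k}" using jk by auto
      let ?zs = "replicate (length \<gamma>) z"
      have zz: "?zs \<in> lists (insert z \<Sigma>)" by (simp add: in_lists_conv_set)
      have lists: "\<gamma> \<in> lists (insert z \<Sigma>)" "\<delta> \<in> lists (insert z \<Sigma>)" using \<gamma> \<delta> by auto
      have "\<gamma> \<noteq> []" using kill p' zero_not_state by auto
      have zero_w: "word_app M z w = z" if "w \<in> lists (insert z \<Sigma>)" for w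
        using that carrier_eq by (intro zero_word) auto
      have w_zero: "word_app M q ?zs = z" if "q \<in> carrier M" for q
      proof -
        obtain m where "length \<gamma> = Suc m" using \<open>\<gamma> \<noteq> []\<close> by (cases \<gamma>) auto
        then show ?thesis
          using zero_w[of "replicate m z"] app_zero[of q z] that carr zero_not_letter
          by (simp add: in_lists_conv_set)
      qed
      have both: "\<phi> (c (insert x R)) = \<phi> (c D)" if R: "R \<subseteq> {h j}" for R
      proof -
        let ?W = "\<lambda>i. if i \<in> R then ?zs else if i \<in> h ` {0..<j} then \<delta> else \<gamma>"
        have "\<phi> (\<lambda>i. word_app M (d j i) (?W i)) = \<phi> (\<lambda>i. word_app M (d k i) (?W i))"
        proof (rule word_cong[OF d_B d_B jk(3)])
          show "?W i \<in> lists (insert z \<Sigma>)" for i using zz lists by simp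
          show "length (?W i) = length \<gamma>" for i using len by simp
          show "finite {i. ?W i \<noteq> \<gamma>}"
            by (rule finite_subset[of _ "insert (h j) (h ` {0..<j})"]) (use R in auto)
        qed
        moreover have "word_app M (d j i) (?W i) = c (insert x R) i" for i
          using R zz lists zero_w w_zero carr eq h_inj by (auto simp: d_def c_def s_def)
        moreover have "word_app M (d k i) (?W i) = c D i" for i
          using R zz lists zero_w w_zero carr eq kill hj sub by (auto simp: d_def c_def s_def D_def)
        ultimately show ?thesis by (simp only:)
      qed
      have "\<phi> (c {x}) = \<phi> (c {x, h j})"
        using both[of "{}"] both[of "{h j}"] by simp
      then show ?thesis using hj by metis
    qed
    define bad where "bad x = {y. \<phi> (c {x, y}) \<noteq> \<phi> (c {x})}" for x
    have "card G \<le> card C" if "G \<subseteq> bad x" "finite G" for G x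
      using link[of G x] that by (fastforce simp: bad_def not_less)
    then have bad: "finite (bad x) \<and> card (bad x) \<le> card C" for x
      by (intro finite_if_finite_subsets_card_bdd) simp
    show "\<exists>v. finite {n. \<phi> (c {n}) \<noteq> v} \<and> card {n. \<phi> (c {n}) \<noteq> v} \<le> card C"
    proof (rule almost_monochromatic[OF C(1)])
      have "c {n} \<in> B" for n by (rule c_B) auto
      then show "range (\<lambda>n. \<phi> (c {n})) \<subseteq> C" using C(2) by blast
      show "finite (bad x)" "card (bad x) \<le> card C" for x using bad[of x] by simp_all
      show "\<phi> (c {x}) = \<phi> (c {y})" if "x \<notin> bad y" "y \<notin> bad x" for x y
        using that by (simp add: bad_def insert_commute)
    qed
  qed simp
qed

section \<open>Finding the two states\<close>

lemma orbit_state: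
  assumes "\<And>t. t \<in> Q \<Longrightarrow> t \<cdot>\<^bsub>M\<^esub> c \<noteq> z \<Longrightarrow> t \<cdot>\<^bsub>M\<^esub> c \<cdot>\<^bsub>M\<^esub> c \<noteq> z"
    and "c \<in> \<Sigma>" "q \<in> Q" "q \<cdot>\<^bsub>M\<^esub> c \<noteq> z"
  shows "word_app M q (replicate n c) \<in> Q"
  using assms(3,4)
proof (induction n arbitrary: q)
  case (Suc n)
  have "q \<cdot>\<^bsub>M\<^esub> c \<in> Q" using state_letter[OF Suc.prems(1) assms(2)] Suc.prems(2) by simp
  then show ?case using Suc.IH assms(1)[OF Suc.prems] by simp
qed simp

lemma orbit_periodic:
  assumes "\<And>n. word_app M q (replicate n c) \<in> Q"
  obtains i \<pi> where "\<pi> > 0"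
    "\<And>k n. i \<le> k \<Longrightarrow> word_app M q (replicate (k + n * \<pi>) c) = word_app M q (replicate k c)"
proof -
  let ?f = "\<lambda>n. word_app M q (replicate n c)"
  have shift: "?f (m + n) = word_app M (?f m) (replicate n c)" for m n
    by (simp add: replicate_add word_app_append)
  have "finite Q" using finite_carrier carrier_eq by simp
  moreover have "range ?f \<subseteq> Q" using assms by blast
  ultimately have "finite (range ?f)" using finite_subset by blast
  then have "\<not> inj ?f" using finite_imageD infinite_UNIV_nat by blast
  then obtain i j where ij: "i < j" "?f i = ?f j"
    unfolding inj_on_def by (metis linorder_neqE_nat)
  have period: "?f (k + (j - i)) = ?f k" if "i \<le> k" for k
  proof -
    have "k + (j - i) = j + (k - i)" "k = i + (k - i)" using ij(1) that by simp_all
    then show ?thesis using shift[of j "k - i"] shift[of i "k - i"] ij(2) by metis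
  qed
  have "?f (k + n * (j - i)) = ?f k" if "i \<le> k" for k n
  proof (induction n)
    case (Suc n)
    then show ?case using period[of "k + n * (j - i)"] that by (simp add: ac_simps)
  qed simp
  then show thesis using that[of "j - i" i] ij(1) by simp
qed

text \<open>The orbit of \<open>u w\<close> under \<open>a\<close> ends in a cycle of length \<open>\<pi>\<close>. The state \<open>p\<close> is chosen on the orbit
  \<open>length w * (\<pi> - 1)\<close> steps ahead: then \<open>length w + i\<close> further steps arrive at the number \<open>i + length w * \<pi>\<close>,
  which is on the cycle at the same place as \<open>i\<close>.\<close>

lemma escape_from_kill:
  assumes use: "\<And>t. t \<in> Q \<Longrightarrow> t \<cdot>\<^bsub>M\<^esub> a \<noteq> z \<Longrightarrow> t \<cdot>\<^bsub>M\<^esub> a \<cdot>\<^bsub>M\<^esub> a \<noteq> z"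
    and a: "a \<in> \<Sigma>" and u: "u \<in> Q" "u \<cdot>\<^bsub>M\<^esub> a = z"
    and w: "w \<in> lists \<Sigma>" "word_app M u w \<in> Q" "word_app M u w \<cdot>\<^bsub>M\<^esub> a \<noteq> z"
  shows "inherently_non_dualizable M"
proof -
  let ?f = "\<lambda>n. word_app M (word_app M u w) (replicate n a)"
  have f: "?f n \<in> Q" for n by (rule orbit_state[OF use a w(2,3)])
  obtain i \<pi> where \<pi>: "\<pi> > 0" and per: "\<And>k n. i \<le> k \<Longrightarrow> ?f (k + n * \<pi>) = ?f k"
    using orbit_periodic[OF f] by metis
  have "w \<noteq> []" using u w(3) by auto
  then obtain m where m: "length w + i = Suc m" by (cases w) auto
  have "word_app M (?f (length w * (\<pi> - 1))) (replicate (length w + i) a)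
      = ?f (length w * (\<pi> - 1) + (length w + i))"
    by (simp add: replicate_add word_app_append)
  also have "length w * (\<pi> - 1) + (length w + i) = i + length w * \<pi>"
    using \<pi> by (cases \<pi>) auto
  also have "?f (i + length w * \<pi>) = ?f i" by (rule per) simp
  finally have p: "word_app M (?f (length w * (\<pi> - 1))) (replicate (length w + i) a) = ?f i" .
  show ?thesis
  proof (rule two_states[OF f u(1)])
    show "replicate (length w + i) a \<in> lists \<Sigma>" "w @ replicate i a \<in> lists \<Sigma>"
      using a w(1) by (auto simp: in_lists_conv_set)
    show "word_app M (?f (length w * (\<pi> - 1))) (replicate (length w + i) a) \<in> Q"
      unfolding p by (rule f)
    show "word_app M u (w @ replicate i a)
        = word_app M (?f (length w * (\<pi> - 1))) (replicate (length w + i) a)"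
      unfolding p by (simp add: word_app_append)
    show "word_app M u (replicate (length w + i) a) = z"
      using zero_word[OF lists_carrier, of "replicate m a"] a by (simp add: m u(2) in_lists_conv_set)
  qed simp
qed

text \<open>The state \<open>u = t a w\<close> is in the range of the last letter \<open>b\<close> of \<open>w\<close>, so it can be followed by \<open>b\<close>
  any number of times. Unless it escapes into the domain of \<open>a\<close>, a late term \<open>s = u b\<^sup>n\<close> is killed by \<open>a\<close> and returns to
  itself under a power of \<open>b\<close>, while \<open>t\<close> is sent to \<open>s\<close> by a word starting with \<open>a\<close>.\<close>

lemma range_to_kill:
  assumes use: "\<And>t c. t \<in> Q \<Longrightarrow> c \<in> \<Sigma> \<Longrightarrow> t \<cdot>\<^bsub>M\<^esub> c \<noteq> z \<Longrightarrow> t \<cdot>\<^bsub>M\<^esub> c \<cdot>\<^bsub>M\<^esub> c \<noteq> z"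
    and a: "a \<in> \<Sigma>" and t: "t \<in> Q"
    and w: "w \<in> lists \<Sigma>" "word_app M t (a # w) \<in> Q" "word_app M t (a # w) \<cdot>\<^bsub>M\<^esub> a = z"
  shows "inherently_non_dualizable M"
proof -
  define u where "u = word_app M t (a # w)"
  have "w \<noteq> []"
  proof
    assume "w = []"
    then have "t \<cdot>\<^bsub>M\<^esub> a \<noteq> z" "t \<cdot>\<^bsub>M\<^esub> a \<cdot>\<^bsub>M\<^esub> a = z" using w(2,3) zero_not_state by auto
    then show False using use[OF t a] by blast
  qed
  then obtain v b where vb: "w = v @ [b]" by (cases w rule: rev_cases) auto
  have b: "b \<in> \<Sigma>" and v: "a # v \<in> lists \<Sigma>" using w(1) a vb by auto
  let ?r = "word_app M t (a # v)"
  have u_eq: "u = ?r \<cdot>\<^bsub>M\<^esub> b" by (simp add: u_def vb word_app_append)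
  have r: "?r \<in> Q" using word_state_prefix[OF t v, of "[b]"] b w(2) by (simp add: vb)
  have "u \<cdot>\<^bsub>M\<^esub> b \<noteq> z"
    using use[OF r b] w(2) zero_not_state unfolding u_eq[symmetric] u_def by metis
  let ?f = "\<lambda>n. word_app M u (replicate n b)"
  have f: "?f n \<in> Q" for n
    by (rule orbit_state) (use use b w(2) \<open>u \<cdot>\<^bsub>M\<^esub> b \<noteq> z\<close> in \<open>auto simp: u_def\<close>)
  show ?thesis
  proof (cases "\<exists>n. ?f n \<cdot>\<^bsub>M\<^esub> a \<noteq> z")
    case True
    then obtain n where "?f n \<cdot>\<^bsub>M\<^esub> a \<noteq> z" ..
    then show ?thesis
      using escape_from_kill[of a u "replicate n b"] use a b f[of 0] f[of n] w(3)
      by (auto simp: u_def in_lists_conv_set)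
  next
    case False
    obtain i \<pi> where \<pi>: "\<pi> > 0" and per: "\<And>k n. i \<le> k \<Longrightarrow> ?f (k + n * \<pi>) = ?f k"
      using orbit_periodic[OF f] by metis
    let ?l = "Suc (length w)"
    \<comment> \<open>The number \<open>n\<close> makes the length \<open>?l + n\<close> of the word \<open>a w b\<^sup>n\<close> a multiple of the period \<open>\<pi>\<close>.\<close>
    define n where "n = (?l + i) * \<pi> - ?l"
    have n: "n + ?l = (?l + i) * \<pi>" "i \<le> n"
    proof -
      have "?l + i \<le> (?l + i) * \<pi>" using mult_le_mono2[of 1 \<pi> "?l + i"] \<pi> by simp
      then show "n + ?l = (?l + i) * \<pi>" "i \<le> n" by (simp_all add: n_def)
    qed
    have s: "word_app M t (a # w @ replicate n b) = ?f n"
      by (simp add: u_def word_app_append)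
    show ?thesis
    proof (rule two_states[OF t f])
      show "a # w @ replicate n b \<in> lists \<Sigma>" "replicate (?l + n) b \<in> lists \<Sigma>"
        using a b w(1) by (auto simp: in_lists_conv_set)
      show "word_app M t (a # w @ replicate n b) \<in> Q" unfolding s by (rule f)
      have "word_app M (?f n) (replicate (?l + n) b) = ?f (n + (?l + n))"
        by (simp only: replicate_add word_app_append)
      also have "n + (?l + n) = n + (?l + i) * \<pi>" using n(1) by simp
      also have "?f (n + (?l + i) * \<pi>) = ?f n" by (rule per[OF n(2)])
      finally show "word_app M (?f n) (replicate (?l + n) b) = word_app M t (a # w @ replicate n b)"
        unfolding s .
      have "w @ replicate n b \<in> lists \<Sigma>" using b w(1) by (auto simp: in_lists_conv_set)
      then have "word_app M z (w @ replicate n b) = z" by (intro zero_word lists_carrier)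
      moreover have "?f n \<cdot>\<^bsub>M\<^esub> a = z" using False by blast
      ultimately show "word_app M (?f n) (a # w @ replicate n b) = z" by simp
    qed simp
  qed
qed

end

theorem corollary2p8:
  fixes M :: "'u::infinite groupoid" and Q \<Sigma> :: "'u set" and z :: 'u
  assumes "automatic_algebra M Q \<Sigma> z"
    and "finite (carrier M)"
    and "\<exists>a\<in>\<Sigma>.
           (\<exists>q\<in>letter_kill M Q z a. \<exists>w\<in>lists \<Sigma>. word_app M q w \<in> letter_dom M Q z a) \<or>
           (\<exists>q\<in>letter_ran M Q z a. \<exists>w\<in>lists \<Sigma>. word_app M q w \<in> letter_kill M Q z a)"
  shows "inherently_non_dualizable M"
proof -
  interpret finite_automatic M Q \<Sigma> z
    using assms(1,2) by unfold_locales
  show ?thesis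
  proof (cases "\<exists>t\<in>Q. \<exists>c\<in>\<Sigma>. t \<cdot>\<^bsub>M\<^esub> c \<noteq> z \<and> t \<cdot>\<^bsub>M\<^esub> c \<cdot>\<^bsub>M\<^esub> c = z")
    case True
    then show ?thesis using single_use_letter by blast
  next
    case False
    then have use: "t \<cdot>\<^bsub>M\<^esub> c \<cdot>\<^bsub>M\<^esub> c \<noteq> z" if "t \<in> Q" "c \<in> \<Sigma>" "t \<cdot>\<^bsub>M\<^esub> c \<noteq> z" for t c
      using that by blast
    obtain a where a: "a \<in> \<Sigma>"
      and cases: "(\<exists>q\<in>letter_kill M Q z a. \<exists>w\<in>lists \<Sigma>. word_app M q w \<in> letter_dom M Q z a) \<or>
        (\<exists>q\<in>letter_ran M Q z a. \<exists>w\<in>lists \<Sigma>. word_app M q w \<in> letter_kill M Q z a)"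
      using assms(3) by blast
    from cases show ?thesis
    proof (elim disjE bexE)
      fix q w assume "q \<in> letter_kill M Q z a" "w \<in> lists \<Sigma>" "word_app M q w \<in> letter_dom M Q z a"
      then show ?thesis
        using escape_from_kill[of a q w] use a by (auto simp: letter_kill_def letter_dom_def)
    next
      fix q w assume q: "q \<in> letter_ran M Q z a" and w: "w \<in> lists \<Sigma>" "word_app M q w \<in> letter_kill M Q z a"
      obtain t where "t \<in> Q" "q = t \<cdot>\<^bsub>M\<^esub> a"
        using q by (auto simp: letter_ran_def letter_dom_def)
      then show ?thesis
        using range_to_kill[of a t w] use a w by (auto simp: letter_kill_def letter_dom_def)
    qed
  qed
qed

end
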